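(* Let $\mathbf{k}=(k_1,\ldots,k_r)$ and $\boldsymbol{\ell}=(\ell_1,\ldots,\ell_s)$ be nonempty finite sequences of positive integers. If $\mathbf{k}\succ\boldsymbol{\ell}$, then the function \[ t\mapsto\frac{\sigma_{\mathbf{k}}(t)}{\sigma_{\boldsymbol{\ell}}(t)} \] is strictly increasing on $(0,1)$.
   Context: Order: $\mathbf{k}\succ\boldsymbol{\ell}$ means that either $\boldsymbol{\ell}$ is a proper prefix of $\mathbf{k}$, or, at the first position $i$ where the two sequences differ, $k_i<\ell_i$. For a nonnegative integrable function $u$ on $(0,1)$ define \[ (\mathsf{M}u)(t)=\int_t^1\frac{u(v)}{v}\,dv,\qquad(\mathsf{C}u)(t)=\int_0^t\frac{u(v)}{1-v}\,dv,\qquad 0<t<1. \] Both operators preserve the total integral over $(0,1)$. For a nonempty finite index $\mathbf{k}=(k_1,\ldots,k_r)$, \[ \sigma_{\mathbf{k}}=\mathsf{M}^{k_1-1}\mathsf{C}\,\mathsf{M}^{k_2-1}\mathsf{C}\cdots\mathsf{C}\,\mathsf{M}^{k_r-1}\mathbf{1}, \] where $\mathbf{1}$ is the constant function $1$, no $\mathsf{C}$ occurs when $r=1$, and compositions are applied from right to left. Each $\sigma_{\mathbf{k}}$ is a positive, locally absolutely continuous function on $(0,1)$. *)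

theory Defs
  imports "HOL-Analysis.Analysis" "HOL-Library.Sublist"
begin

text \<open>
  Functions on the open unit interval are represented by total functions on the reals;
  only their values on the open unit interval are relevant. An index
  is a list of natural numbers; its nonemptiness and the positivity of its entries are
  assumed where the index is used.
\<close>

definition M_op :: "(real \<Rightarrow> real) \<Rightarrow> real \<Rightarrow> real" where
  "M_op u t = (LINT v:{t<..<1}|lebesgue. u v / v)"

definition C_op :: "(real \<Rightarrow> real) \<Rightarrow> real \<Rightarrow> real" where
  "C_op u t = (LINT v:{0<..<t}|lebesgue. u v / (1 - v))"

text \<open>The value on the empty list is deliberately left unspecified.\<close>

fun sigma_fun :: "nat list \<Rightarrow> real \<Rightarrow> real" where
  "sigma_fun [k] = (M_op ^^ (k - 1)) (\<lambda>_. 1)"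
| "sigma_fun (k # k' # ks) = (M_op ^^ (k - 1)) (C_op (sigma_fun (k' # ks)))"

text \<open>A proper extension is larger than its prefix, and a smaller entry at the first
  difference makes an index larger.\<close>

definition index_succ :: "nat list \<Rightarrow> nat list \<Rightarrow> bool" (infix \<open>\<succ>\<close> 50) where
  "k \<succ> l \<longleftrightarrow> strict_prefix l k \<or>
     (\<exists>i. i < length k \<and> i < length l \<and> (\<forall>j<i. k ! j = l ! j) \<and> k ! i < l ! i)"

end

theory Submission imports Defs begin

text \<open>
  Remove the common prefix of the words in \<open>M\<close> and \<open>C\<close> that define the two functions. What remains
  is a pair of functions, the first increasing or constant, the second constant or decreasing,
  and not both constant, because \<open>C u\<close> is strictly increasing and \<open>M u\<close> strictly decreasing
  for positive \<open>u\<close>. Both operators preserve strict monotonicity of a ratio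
  (a monotone form of l'Hospital's rule), which puts the common prefix back.
  The reflection \<open>t \<mapsto> 1 - t\<close> exchanges the two operators.
\<close>

section \<open>Positive integrable functions, increasing ratios and reflection\<close>

definition pos_integrable :: "(real \<Rightarrow> real) \<Rightarrow> bool" where
  "pos_integrable u \<longleftrightarrow> (\<forall>t\<in>{0<..<1}. 0 < u t) \<and> set_integrable lborel {0<..<1} u"

definition ratio_increasing :: "(real \<Rightarrow> real) \<Rightarrow> (real \<Rightarrow> real) \<Rightarrow> bool" where
  "ratio_increasing f g \<longleftrightarrow> strict_mono_on {0<..<1} (\<lambda>t. f t / g t)"

definition reflect :: "(real \<Rightarrow> real) \<Rightarrow> real \<Rightarrow> real" where
  "reflect u t = u (1 - t)"

lemma pos_integrableD:
  assumes "pos_integrable u"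
  shows "0 < t \<Longrightarrow> t < 1 \<Longrightarrow> 0 < u t" "set_integrable lborel {0<..<1} u"
  using assms by (auto simp: pos_integrable_def)

lemma pos_integrable_cong:
  assumes "\<And>t. 0 < t \<Longrightarrow> t < 1 \<Longrightarrow> u t = v t"
  shows "pos_integrable u \<longleftrightarrow> pos_integrable v"
proof -
  have "set_integrable lborel {0<..<1} u \<longleftrightarrow> set_integrable lborel {0<..<1} v"
    by (rule set_integrable_cong) (use assms in auto)
  then show ?thesis
    using assms by (auto simp: pos_integrable_def)
qed

lemma pos_integrable_one: "pos_integrable (\<lambda>_. 1)"
  unfolding pos_integrable_def set_integrable_def by simp

lemma ratio_increasing_cong:
  assumes "\<And>t. 0 < t \<Longrightarrow> t < 1 \<Longrightarrow> f t = f' t" "\<And>t. 0 < t \<Longrightarrow> t < 1 \<Longrightarrow> g t = g' t"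
  shows "ratio_increasing f g \<longleftrightarrow> ratio_increasing f' g'"
  using assms by (auto simp: ratio_increasing_def monotone_on_def)

text \<open>Reflection reverses the monotonicity of the ratio, and passing to the reciprocal of a
  positive ratio reverses it once more; hence \<open>f\<close> and \<open>g\<close> trade
  places.\<close>

lemma ratio_increasing_reflect:
  assumes "pos_integrable f" "pos_integrable g" "ratio_increasing f g"
  shows "ratio_increasing (reflect g) (reflect f)"
  unfolding ratio_increasing_def
proof (rule strict_mono_onI)
  fix s t :: real
  assume st: "s \<in> {0<..<1}" "t \<in> {0<..<1}" "s < t"
  then have "f (1 - t) / g (1 - t) < f (1 - s) / g (1 - s)"
    using assms(3) by (auto simp: ratio_increasing_def intro: strict_mono_onD)
  moreover have "0 < f (1 - s)" "0 < f (1 - t)" "0 < g (1 - s)" "0 < g (1 - t)"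
    using st pos_integrableD(1)[OF assms(1)] pos_integrableD(1)[OF assms(2)] by auto
  ultimately show "reflect g s / reflect f s < reflect g t / reflect f t"
    by (simp add: reflect_def field_simps)
qed

text \<open>If the integral of the nonnegative function vanished, the function would be zero almost
  everywhere, which would make the interval a null set.\<close>

lemma set_integral_pos_Ioo:
  fixes h :: "real \<Rightarrow> real"
  assumes "a < b" "set_integrable lborel {a<..<b} h" "\<And>v. a < v \<Longrightarrow> v < b \<Longrightarrow> 0 < h v"
  shows "0 < (LINT v:{a<..<b}|lborel. h v)"
proof -
  define H where "H = (\<lambda>v. indicator {a<..<b} v *\<^sub>R h v)"
  have int: "integrable lborel H"
    using assms(2) by (simp add: H_def set_integrable_def)
  have nonneg: "0 \<le> H v" for v
    using assms(3)[of v] by (auto simp: H_def indicator_def)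
  have "integral\<^sup>L lborel H \<noteq> 0"
  proof
    assume "integral\<^sup>L lborel H = 0"
    then have "AE v in lborel. H v = 0"
      using integral_nonneg_eq_0_iff_AE[OF int] nonneg by simp
    then have "AE v in lborel. v \<notin> {a<..<b}"
      by eventually_elim (use assms(3) in \<open>force simp: H_def\<close>)
    then have "emeasure lborel {a<..<b} = 0"
      by (subst (asm) AE_iff_measurable[where N = "{a<..<b}"]) auto
    with assms(1) show False by simp
  qed
  moreover have "0 \<le> integral\<^sup>L lborel H"
    using nonneg by (intro integral_nonneg_AE) simp
  ultimately show ?thesis
    by (simp add: H_def set_lebesgue_integral_def)
qed

section \<open>The operator \<open>M_op\<close> on positive integrable functions\<close>

lemma set_integrable_div:
  assumes "pos_integrable u" "0 < a" "b \<le> 1"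
  shows "set_integrable lborel {a<..<b} (\<lambda>v. u v / v)"
proof -
  have *: "set_integrable lborel {a<..<b} u"
    by (rule set_integrable_subset[OF pos_integrableD(2)[OF assms(1)]]) (use assms in auto)
  have eq: "(indicator {a<..<b} v *\<^sub>R (u v / v)) = (indicator {a<..<b} v *\<^sub>R u v) * (1 / v)" for v
    by simp
  \<comment> \<open>Away from zero the factor 1 / v is at most 1 / a, so this multiple of
    \<open>u\<close> dominates.\<close>
  have "integrable lborel (\<lambda>v. (1 / a) * (indicator {a<..<b} v *\<^sub>R u v))"
    using * by (simp add: set_integrable_def)
  then show ?thesis
    unfolding set_integrable_def eq
  proof (rule Bochner_Integration.integrable_bound)
    show "(\<lambda>v. indicator {a<..<b} v *\<^sub>R u v * (1 / v)) \<in> borel_measurable lborel"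
      using borel_measurable_integrable[OF *[unfolded set_integrable_def]]
      by (rule borel_measurable_times) simp
    have "\<bar>u v\<bar> / v \<le> \<bar>u v\<bar> / a" if "a < v" for v
      using that assms(2) by (intro divide_left_mono) auto
    then show "AE v in lborel. norm (indicator {a<..<b} v *\<^sub>R u v * (1 / v))
        \<le> norm (1 / a * (indicator {a<..<b} v *\<^sub>R u v))"
      using assms(2) by (auto simp: indicator_def)
  qed
qed

text \<open>The integral in the definition is over the completed measure. Measurability of the
  integrand, which comes from integrability, allows a return to \<open>lborel\<close>, where Fubini
  and affine substitution are applied.\<close>

lemma M_op_lborel:
  assumes "pos_integrable u" "0 < t"
  shows "M_op u t = (LINT v:{t<..<1}|lborel. u v / v)"
  using set_integrable_div[OF assms order.refl]
  unfolding M_op_def set_lebesgue_integral_def set_integrable_def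
  by (intro integral_completion borel_measurable_integrable)

lemma M_op_split:
  assumes "pos_integrable u" "0 < s" "s < t" "t < 1"
  shows "M_op u s = (LINT v:{s<..<t}|lborel. u v / v) + M_op u t"
proof -
  have "(LINT v:{s<..<1}|lborel. u v / v) = (LINT v:{s<..<t}\<union>{t<..<1}|lborel. u v / v)"
    unfolding set_lebesgue_integral_def
  proof (rule integral_cong_AE)
    have "set_integrable lborel ({s<..<t} \<union> {t<..<1}) (\<lambda>v. u v / v)"
      by (intro set_integrable_Un set_integrable_div) (use assms in auto)
    then show "(\<lambda>v. indicator ({s<..<t} \<union> {t<..<1}) v *\<^sub>R (u v / v)) \<in> borel_measurable lborel"
      unfolding set_integrable_def by (rule borel_measurable_integrable)
    show "(\<lambda>v. indicator {s<..<1} v *\<^sub>R (u v / v)) \<in> borel_measurable lborel"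
      using set_integrable_div[OF assms(1,2) order.refl]
      unfolding set_integrable_def by (rule borel_measurable_integrable)
    \<comment> \<open>The two sets differ only in the point \<open>t\<close>, which is null.\<close>
    show "AE v in lborel. indicator {s<..<1} v *\<^sub>R (u v / v)
        = indicator ({s<..<t} \<union> {t<..<1}) v *\<^sub>R (u v / v)"
      using AE_lborel_singleton[of t] by eventually_elim (use assms in \<open>auto simp: indicator_def\<close>)
  qed
  also have "\<dots> = (LINT v:{s<..<t}|lborel. u v / v) + (LINT v:{t<..<1}|lborel. u v / v)"
    by (intro set_integral_Un set_integrable_div) (use assms in auto)
  finally show ?thesis
    using assms by (simp add: M_op_lborel)
qed

lemma M_op_pos:
  assumes "pos_integrable u" "0 < t" "t < 1"
  shows "0 < M_op u t"
  unfolding M_op_lborel[OF assms(1,2)]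
  by (rule set_integral_pos_Ioo)
    (use assms pos_integrableD(1)[OF assms(1)] in \<open>auto intro: set_integrable_div\<close>)

lemma M_op_strict_decreasing:
  assumes "pos_integrable u" "0 < s" "s < t" "t < 1"
  shows "M_op u t < M_op u s"
proof -
  have "0 < (LINT v:{s<..<t}|lborel. u v / v)"
    by (rule set_integral_pos_Ioo)
      (use assms pos_integrableD(1)[OF assms(1)] in \<open>auto intro: set_integrable_div\<close>)
  then show ?thesis
    using M_op_split[OF assms] by simp
qed

text \<open>Consider u v / v on the triangle 0 < t < v < 1. Integrating over t first cancels the
  denominator and returns \<open>u\<close>, so the function is integrable on the plane; integrating
  over v first gives \<open>M_op u\<close>, which is then integrable by Fubini.\<close>

lemma pos_integrable_M_op:
  assumes "pos_integrable u"
  shows "pos_integrable (M_op u)"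
proof -
  \<comment> \<open>Nothing is assumed about \<open>u\<close> outside the interval, so it is
    extended by zero to make \<open>h\<close> measurable on the whole plane.\<close>
  define w where "w = (\<lambda>v::real. indicator {0<..<1} v *\<^sub>R u v)"
  have w_int: "integrable lborel w"
    using pos_integrableD(2)[OF assms] by (simp add: w_def set_integrable_def)
  have [measurable]: "w \<in> borel_measurable borel"
    using borel_measurable_integrable[OF w_int] by simp
  have w_nonneg: "0 \<le> w v" for v
    using pos_integrableD(1)[OF assms] by (auto simp: w_def indicator_def intro: less_imp_le)
  define h where "h = (\<lambda>(v::real, t::real). if 0 < t \<and> t < v then w v / v else 0)"
  have h_meas [measurable]: "h \<in> borel_measurable (lborel \<Otimes>\<^sub>M lborel)"
    unfolding h_def by measurable
  have h_slice: "h (v, t) = (w v / v) * indicator {0<..<v} t" for v t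
    by (simp add: h_def)
  have inner: "(LINT t|lborel. norm (h (v, t))) = w v" for v
  proof (cases "0 < v")
    case True
    then have "(\<lambda>t. norm (h (v, t))) = (\<lambda>t. (w v / v) * indicator {0<..<v} t)"
      using w_nonneg[of v] by (auto simp: h_slice indicator_def)
    then show ?thesis
      using True by simp
  next
    case False
    then have "w v = 0" by (simp add: w_def)
    then show ?thesis by (simp add: h_slice)
  qed
  have "integrable (lborel \<Otimes>\<^sub>M lborel) h"
  proof (rule lborel_pair.Fubini_integrable[OF h_meas])
    show "integrable lborel (\<lambda>v. LINT t|lborel. norm (h (v, t)))"
      unfolding inner by (rule w_int)
    show "AE v in lborel. integrable lborel (\<lambda>t. h (v, t))"
    proof (rule AE_I2)
      fix v :: real
      have "integrable lborel (indicat_real {0<..<v})"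
        by (cases "0 \<le> v") (auto intro!: integrable_real_indicator)
      then show "integrable lborel (\<lambda>t. h (v, t))"
        unfolding h_slice by (intro integrable_mult_right)
    qed
  qed
  then have "integrable lborel (\<lambda>t. LINT v|lborel. h (v, t))"
    using lborel_pair.integrable_snd[of "\<lambda>v t. h (v, t)"] by simp
  also have "(\<lambda>t. LINT v|lborel. h (v, t)) = (\<lambda>t. indicator {0<..<1} t *\<^sub>R M_op u t)"
  proof
    fix t :: real
    show "(LINT v|lborel. h (v, t)) = indicator {0<..<1} t *\<^sub>R M_op u t"
    proof (cases "t \<in> {0<..<1}")
      case True
      then show ?thesis
        using assms by (auto simp: M_op_lborel set_lebesgue_integral_def h_def w_def indicator_def
            intro!: Bochner_Integration.integral_cong)
    next
      case False
      then have "(\<lambda>v. h (v, t)) = (\<lambda>_. 0)"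
        by (auto simp: h_def w_def indicator_def)
      with False show ?thesis by simp
    qed
  qed
  finally show ?thesis
    using M_op_pos[OF assms] by (simp add: pos_integrable_def set_integrable_def)
qed

text \<open>Compare both sides of \<open>t\<close> with the value \<open>r\<close> of the ratio at
  \<open>t\<close>: to the left \<open>f\<close> lies below \<open>r * g\<close>, to the right above
  it. Splitting the integrals from \<open>s\<close> at \<open>t\<close> turns this into the
  claim.\<close>

lemma ratio_increasing_M_op:
  assumes f: "pos_integrable f" and g: "pos_integrable g" and fg: "ratio_increasing f g"
  shows "ratio_increasing (M_op f) (M_op g)"
  unfolding ratio_increasing_def
proof (rule strict_mono_onI)
  fix s t :: real
  assume "s \<in> {0<..<1}" "t \<in> {0<..<1}" "s < t"
  then have st: "0 < s" "s < t" "t < 1" "0 < t" by auto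
  define r where "r = f t / g t"
  define A where "A = (LINT v:{s<..<t}|lborel. f v / v)"
  define B where "B = (LINT v:{s<..<t}|lborel. g v / v)"
  have cmp: "f v / g v < f v' / g v'" if "0 < v" "v < v'" "v' < 1" for v v'
    using that fg by (auto simp: ratio_increasing_def intro: strict_mono_onD)
  have int: "set_integrable lborel {a<..<b} (\<lambda>v. f v / v)"
      "set_integrable lborel {a<..<b} (\<lambda>v. r * (g v / v))" if "0 < a" "b \<le> 1" for a b
    using that by (auto intro!: set_integrable_mult_right set_integrable_div f g
        simp del: times_divide_eq_right set_integrable_mult_right_iff)
  have "A \<le> (LINT v:{s<..<t}|lborel. r * (g v / v))"
    unfolding A_def
  proof (rule set_integral_mono)
    fix v assume "v \<in> {s<..<t}"
    with st have v: "0 < v" "v < t" "v < 1" by auto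
    have "f v / g v < r"
      using cmp[of v t] v st by (simp add: r_def)
    then have "f v \<le> r * g v"
      using pos_integrableD(1)[OF g] v by (simp add: divide_less_eq less_imp_le)
    then show "f v / v \<le> r * (g v / v)"
      using v by (simp add: divide_right_mono)
  qed (use st in \<open>auto intro!: int simp del: times_divide_eq_right set_integrable_mult_right_iff\<close>)
  then have AB: "A \<le> r * B"
    by (simp add: B_def del: times_divide_eq_right)
  have "0 < (LINT v:{t<..<1}|lborel. f v / v - r * (g v / v))"
  proof (rule set_integral_pos_Ioo)
    fix v assume v: "t < v" "v < 1"
    with st have "r < f v / g v"
      using cmp[of t v] by (simp add: r_def)
    then have "r * g v < f v"
      using pos_integrableD(1)[OF g, of v] v st by (simp add: less_divide_eq)
    then show "0 < f v / v - r * (g v / v)"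
      using v st by (simp add: divide_strict_right_mono)
  qed (use st in \<open>auto intro!: set_integral_diff int
      simp del: times_divide_eq_right set_integrable_mult_right_iff\<close>)
  also have "\<dots> = M_op f t - r * M_op g t"
    using int[of t 1] st f g by (simp add: set_integral_diff M_op_lborel del: times_divide_eq_right)
  finally have MM: "r * M_op g t < M_op f t" by simp
  have "0 < B"
    unfolding B_def by (rule set_integral_pos_Ioo)
      (use st g pos_integrableD(1)[OF g] in \<open>auto intro: set_integrable_div\<close>)
  \<comment> \<open>The part left of \<open>t\<close> contributes only a weak inequality; strictness
    comes from the part right of \<open>t\<close>, together with \<open>B\<close> being
    positive.\<close>
  have "A * M_op g t \<le> B * (r * M_op g t)"
    using mult_right_mono[OF AB, of "M_op g t"] M_op_pos[OF g, of t] st by (simp add: mult_ac)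
  also have "\<dots> < B * M_op f t"
    using MM \<open>0 < B\<close> by simp
  \<comment> \<open>Adding \<open>M_op f t * M_op g t\<close> to both sides completes
    \<open>A\<close> and \<open>B\<close> to the integrals from \<open>s\<close>.\<close>
  finally have "M_op f s * M_op g t < M_op f t * M_op g s"
    using M_op_split[OF f st(1-3)] M_op_split[OF g st(1-3)]
    by (simp add: A_def B_def algebra_simps)
  then show "M_op f s / M_op g s < M_op f t / M_op g t"
    using M_op_pos[OF g, of s] M_op_pos[OF g, of t] st by (simp add: field_simps)
qed

section \<open>The operator \<open>C_op\<close>, treated by reflection\<close>

lemma pos_integrable_reflect:
  assumes "pos_integrable u"
  shows "pos_integrable (reflect u)"
proof -
  have "integrable lborel (\<lambda>v. indicator {0<..<1} (1 + (-1) * v) *\<^sub>R u (1 + (-1) * v))"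
    using pos_integrableD(2)[OF assms] unfolding set_integrable_def
    by (rule lborel_integrable_real_affine) simp
  moreover have "indicator {0<..<1} (1 + (-1) * v) = (indicator {0<..<1} v :: real)" for v :: real
    by (auto simp: indicator_def)
  ultimately show ?thesis
    using pos_integrableD(1)[OF assms]
    by (simp add: pos_integrable_def set_integrable_def reflect_def)
qed

text \<open>The substitution of 1 - v for v carries the kernel 1 / (1 - v) on (0, t) to 1 / v on (1
  - t, 1). So \<open>C_op\<close> is \<open>M_op\<close> conjugated by reflection and inherits its
  properties.\<close>

lemma C_op_reflect:
  assumes "pos_integrable u" "0 < t" "t < 1"
  shows "C_op u t = reflect (M_op (reflect u)) t"
proof -
  let ?h = "\<lambda>v. indicator {0<..<t} v *\<^sub>R (u v / (1 - v))"
  let ?k = "\<lambda>v. indicator {1-t<..<1} v *\<^sub>R (reflect u v / v)"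
  have r: "pos_integrable (reflect u)" by (rule pos_integrable_reflect[OF assms(1)])
  have k: "?h = (\<lambda>v. ?k (1 + (-1) * v))"
    by (auto simp: indicator_def reflect_def)
  have k_int: "integrable lborel ?k"
    using set_integrable_div[OF r, of "1 - t" 1] assms by (simp add: set_integrable_def)
  have "integrable lborel ?h"
    unfolding k by (rule lborel_integrable_real_affine[OF k_int]) simp
  then have "C_op u t = integral\<^sup>L lborel ?h"
    unfolding C_op_def set_lebesgue_integral_def
    by (intro integral_completion borel_measurable_integrable)
  also have "\<dots> = integral\<^sup>L lborel ?k"
    unfolding k by (subst lborel_integral_real_affine[of "-1" ?k 1]) auto
  also have "\<dots> = M_op (reflect u) (1 - t)"
    using M_op_lborel[OF r] assms by (simp add: set_lebesgue_integral_def)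
  finally show ?thesis by (simp add: reflect_def)
qed

lemma pos_integrable_C_op:
  assumes "pos_integrable u"
  shows "pos_integrable (C_op u)"
  using pos_integrable_cong[OF C_op_reflect[OF assms]] assms
  by (simp add: pos_integrable_reflect pos_integrable_M_op)

lemma C_op_strict_increasing:
  assumes "pos_integrable u" "0 < s" "s < t" "t < 1"
  shows "C_op u s < C_op u t"
  using assms M_op_strict_decreasing[OF pos_integrable_reflect[OF assms(1)], of "1 - t" "1 - s"]
  by (simp add: C_op_reflect) (simp add: reflect_def)

text \<open>Conjugation reflects twice, so numerator and denominator are exchanged twice and end up
  in their original order.\<close>

lemma ratio_increasing_C_op:
  assumes "pos_integrable f" "pos_integrable g" "ratio_increasing f g"
  shows "ratio_increasing (C_op f) (C_op g)"
  using ratio_increasing_cong[OF C_op_reflect[OF assms(1)] C_op_reflect[OF assms(2)]] assms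
  by (simp add: ratio_increasing_reflect ratio_increasing_M_op pos_integrable_reflect
      pos_integrable_M_op)

section \<open>Words in the two operators\<close>

lemma pos_integrable_M_op_funpow: "pos_integrable u \<Longrightarrow> pos_integrable ((M_op ^^ n) u)"
  by (induction n) (auto intro: pos_integrable_M_op)

lemma ratio_increasing_M_op_funpow:
  assumes "pos_integrable f" "pos_integrable g" "ratio_increasing f g"
  shows "ratio_increasing ((M_op ^^ n) f) ((M_op ^^ n) g)"
  using assms by (induction n) (auto intro: ratio_increasing_M_op pos_integrable_M_op_funpow)

text \<open>This is what remains of \<open>sigma_fun\<close> after its leading power of
  \<open>M_op\<close> is removed. The constant 1 for the empty list merges the two equations of
  \<open>sigma_fun\<close> into one and avoids its unspecified value.\<close>

definition sigma_tail :: "nat list \<Rightarrow> real \<Rightarrow> real" where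
  "sigma_tail ks = (if ks = [] then (\<lambda>_. 1) else C_op (sigma_fun ks))"

lemma sigma_fun_Cons: "sigma_fun (k # ks) = (M_op ^^ (k - 1)) (sigma_tail ks)"
  by (cases ks) (auto simp: sigma_tail_def)

lemma pos_integrable_sigma_tail: "pos_integrable (sigma_tail ks)"
proof (induction ks)
  case Nil
  then show ?case by (simp add: sigma_tail_def pos_integrable_one)
next
  case (Cons k ks)
  then have "pos_integrable (sigma_fun (k # ks))"
    unfolding sigma_fun_Cons by (rule pos_integrable_M_op_funpow)
  then show ?case
    using pos_integrable_C_op by (simp add: sigma_tail_def)
qed

lemma pos_integrable_sigma_fun: "ks \<noteq> [] \<Longrightarrow> pos_integrable (sigma_fun ks)"
  by (cases ks)
    (auto simp: sigma_fun_Cons intro: pos_integrable_M_op_funpow pos_integrable_sigma_tail)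

text \<open>The inequality is only weak because the tail of a one-entry index is constant.\<close>

lemma sigma_tail_mono:
  assumes "0 < s" "s < t" "t < 1"
  shows "sigma_tail ks s \<le> sigma_tail ks t"
  using assms C_op_strict_increasing[OF pos_integrable_sigma_fun assms, of ks]
  by (auto simp: sigma_tail_def)

text \<open>This settles a first difference between two entries: the larger index has used up its
  power of \<open>M_op\<close> while the other still has one left. The strictly decreasing
  denominator gives strictness even when the numerator is constant.\<close>

lemma ratio_increasing_sigma_tail_M_op:
  assumes g: "pos_integrable g"
  shows "ratio_increasing (sigma_tail ks) (M_op g)"
  unfolding ratio_increasing_def
proof (rule strict_mono_onI)
  fix s t :: real
  assume "s \<in> {0<..<1}" "t \<in> {0<..<1}" "s < t"
  then have st: "0 < s" "s < t" "t < 1" "0 < t" "s < 1" by auto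
  show "sigma_tail ks s / M_op g s < sigma_tail ks t / M_op g t"
    by (rule frac_less2)
      (use st g pos_integrableD(1)[OF pos_integrable_sigma_tail] in
        \<open>auto intro: sigma_tail_mono M_op_pos M_op_strict_decreasing\<close>)
qed

text \<open>This settles the case of a proper prefix, where the shorter index has ended in the
  constant 1 and the longer one goes on with \<open>C_op\<close>.\<close>

lemma ratio_increasing_C_op_one:
  assumes "pos_integrable u"
  shows "ratio_increasing (C_op u) (\<lambda>_. 1)"
  using C_op_strict_increasing[OF assms]
  by (auto simp: ratio_increasing_def intro!: strict_mono_onI)

section \<open>The order on indices and the induction along it\<close>

lemma index_succ_Cons_Cons: "a # k \<succ> b # l \<Longrightarrow> a < b \<or> a = b \<and> k \<succ> l"
  unfolding index_succ_def
proof (elim disjE exE conjE)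
  fix i
  assume i: "i < length (a # k)" "i < length (b # l)" "\<forall>j<i. (a # k) ! j = (b # l) ! j"
    "(a # k) ! i < (b # l) ! i"
  show "a < b \<or> a = b \<and> (strict_prefix l k \<or>
     (\<exists>i. i < length k \<and> i < length l \<and> (\<forall>j<i. k ! j = l ! j) \<and> k ! i < l ! i))"
  proof (cases i)
    case 0
    with i show ?thesis by simp
  next
    case (Suc m)
    have "a = b"
      using i(3)[rule_format, of 0] Suc by simp
    moreover have "\<forall>j<m. k ! j = l ! j"
      using i(3) Suc by (auto dest: spec[of _ "Suc _"])
    ultimately show ?thesis
      using i(1,2,4) Suc by auto
  qed
qed auto

lemma not_Nil_index_succ: "\<not> [] \<succ> l"
  by (simp add: index_succ_def)

lemma ratio_increasing_sigma_fun:
  assumes "k \<noteq> []" "\<forall>n\<in>set k. n > 0" "l \<noteq> []" "k \<succ> l"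
  shows "ratio_increasing (sigma_fun k) (sigma_fun l)"
  using assms
proof (induction k arbitrary: l)
  case (Cons a k)
  then obtain b l' where l: "l = b # l'" by (cases l) auto
  have "a < b \<or> a = b \<and> k \<succ> l'"
    using index_succ_Cons_Cons Cons.prems l by blast
  then show ?case
  proof (elim disjE conjE)
    assume "a < b"
    \<comment> \<open>Positivity matters here: with truncated subtraction the entries 0 and 1 would
      give the same power of \<open>M_op\<close>.\<close>
    moreover obtain m where a: "a = Suc m"
      using Cons.prems by (cases a) auto
    \<comment> \<open>The exponent \<open>b - 1\<close> is then \<open>m + Suc n\<close>: beyond the
      \<open>m\<close> common factors, at least one \<open>M_op\<close> remains in front of the tail
      \<open>l'\<close>.\<close>
    ultimately obtain n where b: "b = Suc m + Suc n"
      using less_imp_Suc_add[of a b] by auto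
    have "sigma_fun (a # k) = (M_op ^^ m) (sigma_tail k)"
      by (simp add: a sigma_fun_Cons)
    moreover have "sigma_fun l = (M_op ^^ m) (M_op ((M_op ^^ n) (sigma_tail l')))"
      unfolding l b sigma_fun_Cons by (simp add: funpow_add del: add_Suc_right)
    ultimately show ?thesis
      by (simp add: ratio_increasing_M_op_funpow ratio_increasing_sigma_tail_M_op
          pos_integrable_M_op pos_integrable_M_op_funpow pos_integrable_sigma_tail)
  next
    assume ab: "a = b" and kl: "k \<succ> l'"
    then have k: "k \<noteq> []" using not_Nil_index_succ by auto
    \<comment> \<open>With equal heads both functions carry the same power of \<open>M_op\<close>,
      so comparing the tails is enough.\<close>
    have "ratio_increasing (sigma_tail k) (sigma_tail l')"
    proof (cases "l' = []")
      case True
      with k show ?thesis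
        by (simp add: sigma_tail_def ratio_increasing_C_op_one pos_integrable_sigma_fun)
    next
      case False
      then have "ratio_increasing (sigma_fun k) (sigma_fun l')"
        using Cons.IH[of l'] Cons.prems k kl by simp
      with k False show ?thesis
        by (simp add: sigma_tail_def ratio_increasing_C_op pos_integrable_sigma_fun)
    qed
    then show ?thesis
      by (simp add: l ab sigma_fun_Cons ratio_increasing_M_op_funpow pos_integrable_sigma_tail)
  qed
qed simp

theorem proposition4p4:
  fixes k l :: "nat list"
  assumes "k \<noteq> []" and "\<forall>n\<in>set k. n > 0"
    and "l \<noteq> []" and "\<forall>n\<in>set l. n > 0"
    and "k \<succ> l"
  shows "strict_mono_on {0<..<1} (\<lambda>t. sigma_fun k t / sigma_fun l t)"
  using ratio_increasing_sigma_fun[OF assms(1-3,5)] by (simp add: ratio_increasing_def)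

end
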